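(* Let $m\ge 1$ and let $\varphi:\mathbb{R}^{m}\longrightarrow\mathbb{H}_{3}$ with $$\varphi (X)=\begin{pmatrix} a_{11} & a_{12} & \ldots & a_{1m}\\ a_{21} & a_{22} & \ldots & a_{2m}\\ a_{31} & a_{32} & \ldots & a_{3m}\end{pmatrix}\begin{pmatrix}x_{1}\\ x_{2}\\ \vdots\\ x_{m}\end{pmatrix}$$ (with real coefficients $a_{ij}$) be a linear map from Euclidean space into Heisenberg space $\mathbb{H}_3$. Let $A^1=(a_{11},\ldots,a_{1m})$ and $A^2=(a_{21},\ldots,a_{2m})$ be the first two row vectors of the matrix. Then $\varphi$ is $\infty$-harmonic if and only if $A^{1}$ and $A^{2}$ are proportional to each other.
   Context: A smooth map $\varphi:(M,g)\to(N,h)$ between Riemannian manifolds is called $\infty$-harmonic if $\mathrm{d}\varphi(\mathrm{grad}\,|\mathrm{d}\varphi|^2)=0$ on $M$, where $|\mathrm{d}\varphi|^2=\mathrm{Trace}_g\,\varphi^*h$ is the energy density of $\varphi$ and $\mathrm{grad}$ is the gradient with respect to $g$. Heisenberg space is $\mathbb{H}_3=(\mathbb{R}^3,g)$ with, in the standard coordinates $(x,y,z)$, the metric $g=\mathrm{d}x^2+\mathrm{d}y^2+\left(\mathrm{d}z+\frac{y}{2}\mathrm{d}x-\frac{x}{2}\mathrm{d}y\right)^2$. The space $\mathbb{R}^m$ carries the standard Euclidean metric. A linear map means a map that is linear in these standard coordinates. Two vectors are "proportional to each other" if they are linearly dependent (parallel, the zero vector being allowed). *)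

theory Defs
  imports "HOL-Analysis.Analysis"
begin

text \<open>
  Riemannian manifolds with a global chart: the underlying manifold is \<open>real ^ 'n\<close>, every tangent
  space is identified with \<open>real ^ 'n\<close> through the coordinate frame, and \<open>g p u v\<close> is the value
  of the metric at the point \<open>p\<close> on the tangent vectors \<open>u\<close> and \<open>v\<close>.
\<close>

type_synonym 'n metric_field = "real ^ 'n \<Rightarrow> real ^ 'n \<Rightarrow> real ^ 'n \<Rightarrow> real"

text \<open>In finite dimension, being of class \<open>C (k + 1)\<close> is equivalent to being differentiable with all
  directional derivatives of class \<open>C k\<close>.\<close>

primrec class_C :: "nat \<Rightarrow> ('a::euclidean_space \<Rightarrow> 'b::real_normed_vector) \<Rightarrow> bool" where
  "class_C 0 f \<longleftrightarrow> continuous_on UNIV f"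
| "class_C (Suc k) f \<longleftrightarrow>
     (\<forall>p. f differentiable (at p)) \<and> (\<forall>v. class_C k (\<lambda>p. frechet_derivative f (at p) v))"

definition smooth_map :: "('a::euclidean_space \<Rightarrow> 'b::real_normed_vector) \<Rightarrow> bool" where
  "smooth_map f \<longleftrightarrow> (\<forall>k. class_C k f)"

definition riemannian_metric :: "'n::finite metric_field \<Rightarrow> bool" where
  "riemannian_metric g \<longleftrightarrow>
     (\<forall>p. bilinear (g p)) \<and>
     (\<forall>p u v. g p u v = g p v u) \<and>
     (\<forall>p v. v \<noteq> 0 \<longrightarrow> g p v v > 0) \<and>
     (\<forall>u v. smooth_map (\<lambda>p. g p u v))"

definition gram_matrix :: "'n::finite metric_field \<Rightarrow> real ^ 'n \<Rightarrow> real ^ 'n ^ 'n" where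
  "gram_matrix g p = (\<chi> i j. g p (axis i 1) (axis j 1))"

text \<open>The contraction \<open>g\<^sup>i\<^sup>j b\<^sub>i\<^sub>j\<close> of a bilinear form \<open>b\<close> on the tangent space at \<open>p\<close>.\<close>

definition trace_wrt ::
    "'n::finite metric_field \<Rightarrow> real ^ 'n \<Rightarrow> (real ^ 'n \<Rightarrow> real ^ 'n \<Rightarrow> real) \<Rightarrow> real" where
  "trace_wrt g p b =
     (\<Sum>i\<in>UNIV. \<Sum>j\<in>UNIV. matrix_inv (gram_matrix g p) $ i $ j * b (axis i 1) (axis j 1))"

definition pullback :: "(real ^ 'm::finite \<Rightarrow> real ^ 'n::finite) \<Rightarrow> 'n metric_field \<Rightarrow> 'm metric_field" where
  "pullback \<phi> h p u v =
     h (\<phi> p) (frechet_derivative \<phi> (at p) u) (frechet_derivative \<phi> (at p) v)"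

definition energy_density ::
    "'m::finite metric_field \<Rightarrow> 'n::finite metric_field \<Rightarrow> (real ^ 'm \<Rightarrow> real ^ 'n) \<Rightarrow> real ^ 'm \<Rightarrow> real" where
  "energy_density g h \<phi> p = trace_wrt g p (pullback \<phi> h p)"

definition grad :: "'n::finite metric_field \<Rightarrow> (real ^ 'n \<Rightarrow> real) \<Rightarrow> real ^ 'n \<Rightarrow> real ^ 'n" where
  "grad g f p = (THE v. \<forall>w. g p v w = frechet_derivative f (at p) w)"

definition infinity_harmonic ::
    "'m::finite metric_field \<Rightarrow> 'n::finite metric_field \<Rightarrow> (real ^ 'm \<Rightarrow> real ^ 'n) \<Rightarrow> bool" where
  "infinity_harmonic g h \<phi> \<longleftrightarrow>
     smooth_map \<phi> \<and> (\<forall>p. frechet_derivative \<phi> (at p) (grad g (energy_density g h \<phi>) p) = 0)"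

definition flat_metric :: "'n::finite metric_field" where
  "flat_metric p u v = u \<bullet> v"

text \<open>The one-form \<open>dz + (y / 2) dx - (x / 2) dy\<close>, where \<open>(x, y, z) = (p $ 1, p $ 2, p $ 3)\<close>.\<close>

definition heisenberg_form :: "real ^ 3 \<Rightarrow> real ^ 3 \<Rightarrow> real" where
  "heisenberg_form p u = u $ 3 + p $ 2 / 2 * u $ 1 - p $ 1 / 2 * u $ 2"

definition heisenberg_metric :: "3 metric_field" where
  "heisenberg_metric p u v =
     u $ 1 * v $ 1 + u $ 2 * v $ 2 + heisenberg_form p u * heisenberg_form p v"

text \<open>Linear dependence of the pair \<open>(u, v)\<close>; \<open>dependent {u, v}\<close> would be wrong for \<open>u = v \<noteq> 0\<close>.\<close>

definition proportional :: "'a::real_vector \<Rightarrow> 'a \<Rightarrow> bool" where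
  "proportional u v \<longleftrightarrow> (\<exists>a b. (a \<noteq> 0 \<or> b \<noteq> 0) \<and> a *\<^sub>R u + b *\<^sub>R v = 0)"

lemma class_C_const: "class_C k (\<lambda>p. c)"
  by (induction k arbitrary: c) auto

lemma class_C_linear:
  assumes "linear f"
  shows "class_C k f"
proof (cases k)
  case 0
  then show ?thesis using assms by (simp add: linear_continuous_on linear_conv_bounded_linear)
next
  case (Suc n)
  have "(f has_derivative f) (at p)" for p
    using assms by (simp add: linear_conv_bounded_linear bounded_linear_imp_has_derivative)
  then have "frechet_derivative f (at p) = f" "f differentiable (at p)" for p
    by (auto simp: differentiable_def dest: frechet_derivative_at[symmetric])
  then show ?thesis by (simp add: Suc class_C_const)
qed

lemma class_C_SucD: "class_C (Suc k) f \<Longrightarrow> class_C k f"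
proof (induction k arbitrary: f)
  case 0
  then show ?case
    by (auto intro!: differentiable_imp_continuous_on simp: differentiable_on_def differentiable_at_withinI)
qed auto

lemma class_C_add: "class_C k f \<Longrightarrow> class_C k g \<Longrightarrow> class_C k (\<lambda>p. f p + g p)"
proof (induction k arbitrary: f g)
  case (Suc k)
  then have "frechet_derivative (\<lambda>p. f p + g p) (at p) v =
      frechet_derivative f (at p) v + frechet_derivative g (at p) v" for p v
    by (subst frechet_derivative_at[symmetric, of _ "\<lambda>v. frechet_derivative f (at p) v + frechet_derivative g (at p) v"])
       (auto intro!: has_derivative_add simp: frechet_derivative_works)
  with Suc show ?case by simp
qed (simp add: continuous_on_add)

lemma class_C_mult:
  fixes f g :: "'a::euclidean_space \<Rightarrow> real"
  shows "class_C k f \<Longrightarrow> class_C k g \<Longrightarrow> class_C k (\<lambda>p. f p * g p)"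
proof (induction k arbitrary: f g)
  case (Suc k)
  then have "frechet_derivative (\<lambda>p. f p * g p) (at p) v =
      f p * frechet_derivative g (at p) v + frechet_derivative f (at p) v * g p" for p v
    by (subst frechet_derivative_at[symmetric, of _ "\<lambda>v. f p * frechet_derivative g (at p) v + frechet_derivative f (at p) v * g p"])
       (auto intro!: has_derivative_mult simp: frechet_derivative_works)
  with Suc show ?case using class_C_SucD[OF Suc.prems(1)] class_C_SucD[OF Suc.prems(2)]
    by (auto intro!: class_C_add)
qed (simp add: continuous_on_mult)

lemma smooth_map_linear: "linear f \<Longrightarrow> smooth_map f"
  by (simp add: smooth_map_def class_C_linear)

lemma riemannian_metric_flat: "riemannian_metric (flat_metric :: 'n::finite metric_field)"
proof -
  have "flat_metric p = (\<bullet>)" for p :: "real ^ 'n"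
    by (intro ext) (simp add: flat_metric_def)
  then show ?thesis
    by (auto simp: riemannian_metric_def smooth_map_def class_C_const inner_commute
        bilinear_conv_bounded_bilinear bounded_bilinear_inner)
qed

lemma riemannian_metric_heisenberg: "riemannian_metric heisenberg_metric"
  unfolding riemannian_metric_def
proof (intro conjI allI impI)
  show "bilinear (heisenberg_metric p)" for p
    by (auto simp: bilinear_def heisenberg_metric_def heisenberg_form_def add_divide_distrib
        algebra_simps intro!: linearI)
  show "heisenberg_metric p u v = heisenberg_metric p v u" for p u v
    by (simp add: heisenberg_metric_def algebra_simps)
  show "heisenberg_metric p v v > 0" if "v \<noteq> 0" for p v
  proof -
    have nn: "heisenberg_metric p v v = (v $ 1)\<^sup>2 + (v $ 2)\<^sup>2 + (heisenberg_form p v)\<^sup>2"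
      by (simp add: heisenberg_metric_def power2_eq_square)
    have "heisenberg_metric p v v \<noteq> 0"
    proof
      assume "heisenberg_metric p v v = 0"
      then have "v $ 1 = 0" "v $ 2 = 0" "heisenberg_form p v = 0"
        by (simp_all add: nn add_nonneg_eq_0_iff)
      then show False using that by (simp add: heisenberg_form_def vec_eq_iff forall_3)
    qed
    moreover have "heisenberg_metric p v v \<ge> 0" by (simp add: nn)
    ultimately show ?thesis by linarith
  qed
  show "smooth_map (\<lambda>p. heisenberg_metric p u v)" for u v
  proof -
    have "class_C k (\<lambda>p. heisenberg_form p w)" for k and w :: "real ^ 3"
    proof -
      have "class_C k (\<lambda>p. w $ 3 + (p $ 2 / 2 * w $ 1 - p $ 1 / 2 * w $ 2))"
        by (intro class_C_add class_C_const class_C_linear linearI) (auto simp: field_simps)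
      then show ?thesis by (simp add: heisenberg_form_def algebra_simps)
    qed
    then show ?thesis
      by (auto simp: smooth_map_def heisenberg_metric_def intro!: class_C_add class_C_mult class_C_const)
  qed
qed

lemma grad_eqI:
  assumes "riemannian_metric g" and "\<And>w. g p v w = frechet_derivative f (at p) w"
  shows "grad g f p = v"
  unfolding grad_def
proof (rule the_equality)
  show "\<forall>w. g p v w = frechet_derivative f (at p) w" using assms(2) by simp
  fix u assume u: "\<forall>w. g p u w = frechet_derivative f (at p) w"
  have "bilinear (g p)" using assms(1) by (simp add: riemannian_metric_def)
  then have "g p (u - v) (u - v) = 0"
    using u assms(2) by (simp add: bilinear_lsub)
  then have "u - v = 0"
    using assms(1) unfolding riemannian_metric_def by (metis less_irrefl)
  then show "u = v" by simp
qed

end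

theory Submission
  imports Defs
begin

text \<open>
  Write \<open>a\<close>, \<open>b\<close>, \<open>c\<close> for the rows of \<open>A\<close>. The pullback of the Heisenberg one-form is the inner
  product with \<open>w X = c + (b \<bullet> X / 2) a - (a \<bullet> X / 2) b\<close>, so the energy density is
  \<open>|a|\<^sup>2 + |b|\<^sup>2 + |w X|\<^sup>2\<close>, with gradient \<open>G = (w X \<bullet> a) b - (w X \<bullet> b) a\<close>. As \<open>G\<close> lies in the
  span of \<open>a\<close> and \<open>b\<close>, it is killed by \<open>A\<close> iff it vanishes. It clearly vanishes if \<open>a\<close> and \<open>b\<close> are
  proportional; otherwise \<open>w X \<bullet> a = 0\<close> for all \<open>X\<close>, and the part of this affine function
  that is linear in \<open>X\<close> yields \<open>|a|\<^sup>2 b = (a \<bullet> b) a\<close>, a contradiction.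
\<close>

lemma trace_wrt_flat: "trace_wrt flat_metric p b = (\<Sum>i\<in>UNIV. b (axis i 1) (axis i 1))"
proof -
  have "gram_matrix flat_metric p = mat 1"
    by (simp add: gram_matrix_def flat_metric_def mat_def vec_eq_iff inner_axis_axis)
  moreover have "matrix_inv (mat 1 :: real ^ 'a ^ 'a) = mat 1"
    by (simp add: matrix_inv_def)
  ultimately show ?thesis
    by (simp add: trace_wrt_def mat_def if_distrib[of "\<lambda>x. x * _"] cong: if_cong)
qed

lemma frechet_derivative_matrix:
  fixes A :: "real ^ 'm ^ 'n"
  shows "frechet_derivative (\<lambda>X. A *v X) (at p) = (*v) A"
  by (rule frechet_derivative_at[symmetric])
    (simp add: bounded_linear_imp_has_derivative matrix_vector_mul_bounded_linear)

text \<open>The vector \<open>w X\<close> of the overview.\<close>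

definition heisenberg_row :: "real ^ 'm ^ 3 \<Rightarrow> real ^ 'm \<Rightarrow> real ^ 'm" where
  "heisenberg_row A X =
     row 3 A + (row 2 A \<bullet> X / 2) *\<^sub>R row 1 A - (row 1 A \<bullet> X / 2) *\<^sub>R row 2 A"

lemma matrix_vector_mult_row_component:
  fixes A :: "real ^ 'm ^ 'n"
  shows "(A *v X) $ i = row i A \<bullet> X"
  by (simp add: matrix_vector_mul_component row_def)

lemma heisenberg_form_linear: "heisenberg_form (A *v X) (A *v u) = heisenberg_row A X \<bullet> u"
  by (simp add: heisenberg_form_def heisenberg_row_def matrix_vector_mult_row_component
      inner_diff_left inner_add_left)

text \<open>The Heisenberg metric is a sum of three squared one-forms. Each pulls back to the inner
  product with a vector, and the flat trace of its square is the squared norm of that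
  vector.\<close>

lemma energy_density_linear:
  "energy_density flat_metric heisenberg_metric (\<lambda>X. A *v X) X =
     row 1 A \<bullet> row 1 A + row 2 A \<bullet> row 2 A + heisenberg_row A X \<bullet> heisenberg_row A X"
  by (simp add: energy_density_def trace_wrt_flat pullback_def frechet_derivative_matrix
      heisenberg_metric_def heisenberg_form_linear matrix_vector_mult_row_component inner_axis
      sum.distrib inner_vec_def[of "row _ _" "row _ _"]
      inner_vec_def[of "heisenberg_row _ _" "heisenberg_row _ _"])

lemma has_derivative_energy_density_linear:
  "(energy_density flat_metric heisenberg_metric (\<lambda>X. A *v X) has_derivative
     (\<lambda>u. ((heisenberg_row A X \<bullet> row 1 A) *\<^sub>R row 2 A - (heisenberg_row A X \<bullet> row 2 A) *\<^sub>R row 1 A) \<bullet> u))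
   (at X)"
proof -
  have "(heisenberg_row A has_derivative
      (\<lambda>u. (row 2 A \<bullet> u / 2) *\<^sub>R row 1 A - (row 1 A \<bullet> u / 2) *\<^sub>R row 2 A)) (at X)"
    unfolding heisenberg_row_def by (auto intro!: derivative_eq_intros)
  \<comment> \<open>The factor 2 from differentiating the square cancels the halves in
    \<open>heisenberg_row\<close>.\<close>
  from has_derivative_add[OF has_derivative_const has_derivative_inner[OF this this]] show ?thesis
    unfolding energy_density_linear
    by (rule has_derivative_eq_rhs)
      (simp add: inner_simps inner_commute algebra_simps)
qed

lemma grad_energy_density_linear:
  "grad flat_metric (energy_density flat_metric heisenberg_metric (\<lambda>X. A *v X)) X =
     (heisenberg_row A X \<bullet> row 1 A) *\<^sub>R row 2 A - (heisenberg_row A X \<bullet> row 2 A) *\<^sub>R row 1 A"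
  by (rule grad_eqI[OF riemannian_metric_flat])
    (simp add: flat_metric_def
      frechet_derivative_at[OF has_derivative_energy_density_linear, symmetric])

text \<open>A vector in the kernel of \<open>A\<close> is orthogonal to every row, so one that also
  lies in the span of the rows is orthogonal to itself.\<close>

lemma mult_span_rows_eq_0_iff:
  fixes A :: "real ^ 'm ^ 'n"
  shows "A *v (s *\<^sub>R row i A - t *\<^sub>R row j A) = 0 \<longleftrightarrow> s *\<^sub>R row i A - t *\<^sub>R row j A = 0"
    (is "A *v ?G = 0 \<longleftrightarrow> _")
proof
  assume "A *v ?G = 0"
  then have "row k A \<bullet> ?G = 0" for k
    by (metis matrix_vector_mult_row_component zero_index)
  moreover have "?G \<bullet> ?G = s * (row i A \<bullet> ?G) - t * (row j A \<bullet> ?G)"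
    by (simp only: inner_diff_left inner_scaleR_left)
  ultimately show "?G = 0" by (metis diff_self inner_eq_zero_iff mult_zero_right)
qed simp

lemma proportional_imp_wedge_eq_0:
  fixes u v w :: "'a::real_inner"
  assumes "proportional u v"
  shows "(w \<bullet> u) *\<^sub>R v - (w \<bullet> v) *\<^sub>R u = 0"
proof -
  obtain r s where rs: "r \<noteq> 0 \<or> s \<noteq> 0" "r *\<^sub>R u + s *\<^sub>R v = 0"
    using assms by (auto simp: proportional_def)
  then have *: "r *\<^sub>R u = - (s *\<^sub>R v)" "s *\<^sub>R v = - (r *\<^sub>R u)"
    by (simp_all add: eq_neg_iff_add_eq_0 add.commute)
  have "r * (w \<bullet> u) = - (s * (w \<bullet> v))"
    using arg_cong[OF *(1), of "inner w"] by simp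
  \<comment> \<open>Both multiples vanish by the dependence relation; whichever of \<open>r\<close>
    and \<open>s\<close> is nonzero can be cancelled.\<close>
  then have "r *\<^sub>R ((w \<bullet> u) *\<^sub>R v - (w \<bullet> v) *\<^sub>R u) = - ((w \<bullet> v) *\<^sub>R (r *\<^sub>R u + s *\<^sub>R v))"
    "s *\<^sub>R ((w \<bullet> u) *\<^sub>R v - (w \<bullet> v) *\<^sub>R u) = (w \<bullet> u) *\<^sub>R (r *\<^sub>R u + s *\<^sub>R v)"
    by (simp_all add: scaleR_right_diff_distrib scaleR_add_right mult.commute)
  then show ?thesis using rs by auto
qed

lemma proportional_if_heisenberg_wedge_eq_0:
  fixes A :: "real ^ 'm ^ 3"
  assumes "\<And>X. (heisenberg_row A X \<bullet> row 1 A) *\<^sub>R row 2 A - (heisenberg_row A X \<bullet> row 2 A) *\<^sub>R row 1 A = 0"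
  shows "proportional (row 1 A) (row 2 A)"
proof (rule ccontr)
  let ?a = "row 1 A" and ?b = "row 2 A"
  assume np: "\<not> proportional ?a ?b"
  have w: "heisenberg_row A X \<bullet> ?a = 0" for X
  proof (rule ccontr)
    assume "heisenberg_row A X \<bullet> ?a \<noteq> 0"
    moreover have "(- (heisenberg_row A X \<bullet> ?b)) *\<^sub>R ?a + (heisenberg_row A X \<bullet> ?a) *\<^sub>R ?b = 0"
      using assms[of X] by (simp add: algebra_simps)
    ultimately show False using np unfolding proportional_def by metis
  qed
  \<comment> \<open>The value at 0 isolates the constant term; what remains is linear in
    \<open>X\<close>.\<close>
  have "row 3 A \<bullet> ?a = 0"
    using w[of 0] by (simp add: heisenberg_row_def)
  then have "((?a \<bullet> ?a) *\<^sub>R ?b - (?a \<bullet> ?b) *\<^sub>R ?a) \<bullet> X = 0" for X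
    using w[of X] by (simp add: heisenberg_row_def inner_simps inner_commute algebra_simps)
  \<comment> \<open>Take \<open>X\<close> to be the left factor itself. By independence the
    coefficient \<open>?a \<bullet> ?a\<close> must then vanish.\<close>
  then have "(- (?a \<bullet> ?b)) *\<^sub>R ?a + (?a \<bullet> ?a) *\<^sub>R ?b = 0"
    by (metis inner_eq_zero_iff add.commute scaleR_minus_left uminus_add_conv_diff)
  then have "?a = 0" using np by (metis inner_eq_zero_iff proportional_def)
  then have "1 *\<^sub>R ?a + 0 *\<^sub>R ?b = 0" by simp
  then show False using np zero_neq_one unfolding proportional_def by metis
qed

theorem theorem2p2:
  fixes A :: "real ^ 'm ^ 3"
  shows "infinity_harmonic flat_metric heisenberg_metric (\<lambda>X. A *v X) \<longleftrightarrow>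
    proportional (row 1 A) (row 2 A)"
proof -
  have "infinity_harmonic flat_metric heisenberg_metric (\<lambda>X. A *v X) \<longleftrightarrow>
    (\<forall>X. (heisenberg_row A X \<bullet> row 1 A) *\<^sub>R row 2 A - (heisenberg_row A X \<bullet> row 2 A) *\<^sub>R row 1 A = 0)"
    by (simp only: infinity_harmonic_def smooth_map_linear matrix_vector_mul_linear
        frechet_derivative_matrix grad_energy_density_linear mult_span_rows_eq_0_iff simp_thms)
  then show ?thesis
    using proportional_imp_wedge_eq_0 proportional_if_heisenberg_wedge_eq_0 by blast
qed

end
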